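(* Let $p\geq 3$ be an odd prime, let $m\geq 1$ be an integer, and let $\zeta_p:\{\xi\in\mathbb{Z}:\gcd(\xi,p)=1\}\to\{0,1\}$ be a function such that (1) if $\gcd(\theta_1,p)=\gcd(\theta_2,p)=1$ and $\theta_1\equiv\theta_2\pmod p$, then $\zeta_p(\theta_1)=\zeta_p(\theta_2)$; (2) the sets $A_i=\{a:\zeta_p(a)=i,\ 1\leq a\leq p-1\}$, $i=0,1$, satisfy $|A_0|=|A_1|=\frac{p-1}{2}$; and (3) $\zeta_p(\theta)=\frac{1+\chi_p(\theta)}{2}$ for a function $\chi_p:\{\xi\in\mathbb{Z}:\gcd(\xi,p)=1\}\to\{-1,1\}$ satisfying $\chi_p(\theta_1\theta_2)=\chi_p(\theta_1)\chi_p(\theta_2)$ for all $\theta_1,\theta_2$ relatively prime to $p$. Let $G$ be a simple connected graph of order $p-1$ and size $m(p-1)+\epsilon$, where $\epsilon\in\{-1,0,1\}$, and let $H$ be a simple graph of order $p-1$ and size $p-1+m$. Let $S=\{1,2,\ldots,p(p-1)\}$. Then the corona graph $G\circ H$ is an arithmetic cordial graph modulo $p$ under $\langle S,\zeta_p,\cdot\rangle$, where $\cdot$ is ordinary multiplication of integers.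
   Context: The order of a graph is its number of vertices and its size is its number of edges. Corona graph: $G\circ H$ is obtained from one copy of $G$ and $|V(G)|$ disjoint copies of $H$ by joining every vertex of the $i$th copy of $H$ to the $i$th vertex of $G$. Arithmetic cordial graph: let $\eta$ be a positive integer, $S\subseteq\mathbb{Z}$, $\star:S\times S\to\mathbb{Z}$ a binary function, and $\zeta_\eta:\{\xi\in\mathbb{Z}:\gcd(\xi,\eta)=1\}\to\{0,1\}$ a function. The triple $\langle S,\zeta_\eta,\star\rangle$ is called an arithmetic structure. For a simple connected graph $\Gamma$ of order $N$, a bijection $f:V(\Gamma)\to S$ (where $|S|=N$) is an arithmetic cordial labeling modulo $\eta$ under $\langle S,\zeta_\eta,\star\rangle$ if the induced function $f_\eta^*:E(\Gamma)\to\{0,1\}$, defined by $f_\eta^*(ab)=0$ if $\gcd(f(a)\star f(b),\eta)\neq 1$ or $\zeta_\eta(f(a)\star f(b))=0$, and $f_\eta^*(ab)=1$ if $\gcd(f(a)\star f(b),\eta)=1$ and $\zeta_\eta(f(a)\star f(b))=1$, satisfies $|e_{f_\eta^*}(0)-e_{f_\eta^*}(1)|\leq 1$, where $e_{f_\eta^*}(i)$ is the number of edges with label $i$. A graph admitting such a labeling is an arithmetic cordial graph modulo $\eta$ under $\langle S,\zeta_\eta,\star\rangle$. *)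

theory Defs
  imports "HOL-Number_Theory.Number_Theory" "Graph_Theory.Graph_Theory"
begin

text \<open>
  A finite simple graph is a \<^locale>\<open>pair_graph\<close>: a finite vertex set with a symmetric, irreflexive
  set of arcs. An edge \<open>ab\<close> corresponds to the two opposite arcs \<open>(a, b)\<close> and \<open>(b, a)\<close>; edges
  are therefore counted as unordered pairs.
\<close>

definition edges :: "'a pair_pre_digraph \<Rightarrow> 'a set set" where
  "edges G = {{u, v} | u v. (u, v) \<in> parcs G}"

definition graph_order :: "'a pair_pre_digraph \<Rightarrow> nat" where
  "graph_order G = card (pverts G)"

definition graph_size :: "'a pair_pre_digraph \<Rightarrow> nat" where
  "graph_size G = card (edges G)"

text \<open>
  The copies of \<open>H\<close> in \<open>G \<circ> H\<close> are indexed by the vertices of \<open>G\<close>: \<open>Inl g\<close> is the vertex \<open>g\<close>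
  of \<open>G\<close>, and \<open>Inr (g, h)\<close> is the vertex \<open>h\<close> in the copy of \<open>H\<close> attached to \<open>g\<close>.
\<close>

definition corona :: "'a pair_pre_digraph \<Rightarrow> 'b pair_pre_digraph \<Rightarrow> ('a + 'a \<times> 'b) pair_pre_digraph" where
  "corona G H = \<lparr>
     pverts = Inl ` pverts G \<union> Inr ` (pverts G \<times> pverts H),
     parcs = {(Inl g, Inl g') | g g'. (g, g') \<in> parcs G}
       \<union> {(Inr (g, h), Inr (g, h')) | g h h'. g \<in> pverts G \<and> (h, h') \<in> parcs H}
       \<union> {(Inl g, Inr (g, h)) | g h. g \<in> pverts G \<and> h \<in> pverts H}
       \<union> {(Inr (g, h), Inl g) | g h. g \<in> pverts G \<and> h \<in> pverts H} \<rparr>"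

abbreviation coprime_ints :: "int \<Rightarrow> int set" where
  "coprime_ints \<eta> \<equiv> {\<xi>. gcd \<xi> \<eta> = 1}"

text \<open>
  The functions \<open>\<zeta> : {\<xi>. gcd \<xi> \<eta> = 1} \<rightarrow> {0, 1}\<close> and \<open>star : S \<times> S \<rightarrow> \<int>\<close> of an arithmetic structure
  are total HOL functions; only their values on the stated domains are ever used.
\<close>

definition label_of_value :: "int \<Rightarrow> (int \<Rightarrow> nat) \<Rightarrow> int \<Rightarrow> nat" where
  "label_of_value \<eta> \<zeta> x = (if gcd x \<eta> \<noteq> 1 \<or> \<zeta> x = 0 then 0 else 1)"

text \<open>
  Since \<open>star\<close> need not be commutative, \<open>f a \<star> f b\<close> may depend on the orientation of the edge \<open>ab\<close>.
  A function \<open>F\<close> on the edges counts as induced by \<open>f\<close> only if the defining equation holds for both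
  orientations, i.e. if the induced label is well defined.
\<close>

definition induced_edge_labeling ::
    "int \<Rightarrow> (int \<Rightarrow> nat) \<Rightarrow> (int \<Rightarrow> int \<Rightarrow> int) \<Rightarrow> 'a pair_pre_digraph \<Rightarrow> ('a \<Rightarrow> int) \<Rightarrow> ('a set \<Rightarrow> nat) \<Rightarrow> bool"
  where
  "induced_edge_labeling \<eta> \<zeta> star \<Gamma> f F \<longleftrightarrow>
     (\<forall>a b. (a, b) \<in> parcs \<Gamma> \<longrightarrow> F {a, b} = label_of_value \<eta> \<zeta> (star (f a) (f b)))"

definition num_edges_labeled :: "'a pair_pre_digraph \<Rightarrow> ('a set \<Rightarrow> nat) \<Rightarrow> nat \<Rightarrow> nat" where
  "num_edges_labeled \<Gamma> F i = card {e \<in> edges \<Gamma>. F e = i}"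

definition arithmetic_cordial_labeling ::
    "int \<Rightarrow> int set \<Rightarrow> (int \<Rightarrow> nat) \<Rightarrow> (int \<Rightarrow> int \<Rightarrow> int) \<Rightarrow> 'a pair_pre_digraph \<Rightarrow> ('a \<Rightarrow> int) \<Rightarrow> bool"
  where
  "arithmetic_cordial_labeling \<eta> S \<zeta> star \<Gamma> f \<longleftrightarrow>
     bij_betw f (pverts \<Gamma>) S \<and>
     (\<exists>F. induced_edge_labeling \<eta> \<zeta> star \<Gamma> f F \<and>
       \<bar>int (num_edges_labeled \<Gamma> F 0) - int (num_edges_labeled \<Gamma> F 1)\<bar> \<le> 1)"

text \<open>
  \<^const>\<open>Digraph_Component.connected\<close> is qualified because \<open>connected\<close> also names the topological notion.
\<close>

definition arithmetic_cordial_graph ::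
    "int \<Rightarrow> int set \<Rightarrow> (int \<Rightarrow> nat) \<Rightarrow> (int \<Rightarrow> int \<Rightarrow> int) \<Rightarrow> 'a pair_pre_digraph \<Rightarrow> bool"
  where
  "arithmetic_cordial_graph \<eta> S \<zeta> star \<Gamma> \<longleftrightarrow>
     0 < \<eta> \<and> \<zeta> \<in> coprime_ints \<eta> \<rightarrow> {0, 1} \<and>
     pair_graph \<Gamma> \<and> Digraph_Component.connected (with_proj \<Gamma>) \<and>
     (\<exists>f. arithmetic_cordial_labeling \<eta> S \<zeta> star \<Gamma> f)"

end

theory Submission
  imports Defs
begin

text \<open>
  Write \<open>n = p - 1\<close>. Among the labels \<open>1, \<dots>, p n\<close> exactly \<open>n\<close> are multiples of \<open>p\<close>, and every nonzero
  residue class modulo \<open>p\<close> contains \<open>n\<close> labels. Give the multiples of \<open>p\<close> to the vertices of the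
  central copy of \<open>G\<close>. Then every edge that meets the central copy carries a product divisible by
  \<open>p\<close> and hence the label \<open>0\<close>; there are \<open>(m n + \<epsilon>) + n\<^sup>2\<close> such edges.

  The labels that are left split by their value under \<open>\<zeta>\<close>. Since \<open>\<zeta>\<close> is periodic modulo \<open>p\<close> and takes
  each value \<open>n / 2\<close> times on the nonzero residues, both parts have \<open>n\<^sup>2 / 2\<close> elements, which is exactly
  the number of vertices in \<open>n / 2\<close> copies of \<open>H\<close>. So the copies of \<open>H\<close> can be filled one at a time with
  labels on which \<open>\<zeta>\<close> is constant (\<open>ex_bij_copies_monochromatic\<close>). On such a copy \<open>\<chi>\<close> is a constant
  \<open>c \<in> {-1, 1}\<close>, and multiplicativity gives every edge of the copy the sign \<open>c \<cdot> c = 1\<close>, hence the label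
  \<open>1\<close>; there are \<open>n (n + m)\<close> such edges.

  The size of \<open>H\<close> makes the two counts differ by exactly \<open>\<epsilon>\<close>.
\<close>

section \<open>Corona graphs\<close>

lemma pverts_corona [simp]:
  "pverts (corona G H) = Inl ` pverts G \<union> Inr ` (pverts G \<times> pverts H)"
  by (simp add: corona_def)

lemma parcs_corona [simp]:
  "(Inl g, Inl g') \<in> parcs (corona G H) \<longleftrightarrow> (g, g') \<in> parcs G"
  "(Inr (g, h), Inr (g', h')) \<in> parcs (corona G H) \<longleftrightarrow> g = g' \<and> g \<in> pverts G \<and> (h, h') \<in> parcs H"
  "(Inl g, Inr (g', h)) \<in> parcs (corona G H) \<longleftrightarrow> g = g' \<and> g \<in> pverts G \<and> h \<in> pverts H"
  "(Inr (g', h), Inl g) \<in> parcs (corona G H) \<longleftrightarrow> g = g' \<and> g \<in> pverts G \<and> h \<in> pverts H"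
  by (auto simp: corona_def)

lemma corona_arc_cases:
  assumes "(a, b) \<in> parcs (corona G H)"
  obtains (centre) g g' where "a = Inl g" "b = Inl g'" "(g, g') \<in> parcs G"
  | (copy) g h h' where "a = Inr (g, h)" "b = Inr (g, h')" "g \<in> pverts G" "(h, h') \<in> parcs H"
  | (outward) g h where "a = Inl g" "b = Inr (g, h)" "g \<in> pverts G" "h \<in> pverts H"
  | (inward) g h where "a = Inr (g, h)" "b = Inl g" "g \<in> pverts G" "h \<in> pverts H"
  using assms by (auto simp: corona_def)

lemma pair_graph_corona:
  assumes "pair_graph G" "pair_graph H"
  shows "pair_graph (corona G H)"
proof -
  interpret G: pair_graph G by fact
  interpret H: pair_graph H by fact
  have wf: "a \<in> pverts (corona G H) \<and> b \<in> pverts (corona G H) \<and> a \<noteq> b \<and> (b, a) \<in> parcs (corona G H)"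
    if "(a, b) \<in> parcs (corona G H)" for a b
    using that
    by (cases rule: corona_arc_cases)
      (auto dest: G.in_arcsD1 G.in_arcsD2 H.in_arcsD1 H.in_arcsD2 G.no_loops' H.no_loops'
        G.arcs_symmetric H.arcs_symmetric)
  have fin: "finite (pverts (corona G H))"
    by (simp add: G.pair_finite_verts H.pair_finite_verts)
  have "parcs (corona G H) \<subseteq> pverts (corona G H) \<times> pverts (corona G H)"
    using wf by fast
  then have "finite (parcs (corona G H))"
    using fin finite_subset by blast
  moreover have "symmetric (with_proj (corona G H))"
    using wf by (auto simp: symmetric_def intro!: symI)
  ultimately show ?thesis
    using wf fin by unfold_locales (auto simp del: pverts_corona)
qed

lemma connected_corona:
  assumes "pair_graph G" "pair_graph H" and conn: "Digraph_Component.connected (with_proj G)"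
  shows "Digraph_Component.connected (with_proj (corona G H))"
proof -
  interpret G: pair_graph G by fact
  interpret C: pair_graph "corona G H" using assms(1,2) by (rule pair_graph_corona)
  have sc: "strongly_connected (with_proj G)"
    using G.symmetric_connected_imp_strongly_connected[OF G.sym_arcs conn] .
  have centre: "Inl u \<rightarrow>\<^sup>*\<^bsub>with_proj (corona G H)\<^esub> Inl v"
    if "u \<rightarrow>\<^sup>*\<^bsub>with_proj G\<^esub> v" for u v
    using that
  proof (induction rule: G.reachable_induct)
    case base
    then show ?case by (intro C.reachable_refl) simp
  next
    case (step x y)
    then show ?case by (intro C.reachable_adj_trans[OF step.IH]) simp
  qed
  \<comment> \<open>Every vertex reaches its hub in at most one step, so connectivity is inherited from \<open>G\<close>.\<close>
  define hub :: "'a + 'a \<times> 'b \<Rightarrow> 'a" where "hub = case_sum id fst"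
  have hub: "hub x \<in> pverts G \<and> x \<rightarrow>\<^sup>*\<^bsub>with_proj (corona G H)\<^esub> Inl (hub x)"
    if "x \<in> pverts (corona G H)" for x
  proof (cases x)
    case (Inl g)
    with that show ?thesis by (auto simp: hub_def intro!: C.reachable_refl)
  next
    case (Inr y)
    with that show ?thesis by (auto simp: hub_def intro!: C.reachable_adjI)
  qed
  have "x \<rightarrow>\<^sup>*\<^bsub>with_proj (corona G H)\<^esub> y"
    if x: "x \<in> pverts (corona G H)" and y: "y \<in> pverts (corona G H)" for x y
  proof -
    have "hub x \<rightarrow>\<^sup>*\<^bsub>with_proj G\<^esub> hub y"
      using sc hub[OF x] hub[OF y] by (auto simp: strongly_connected_def)
    then have "x \<rightarrow>\<^sup>*\<^bsub>with_proj (corona G H)\<^esub> Inl (hub y)"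
      using hub[OF x] centre C.reachable_trans by blast
    moreover have "Inl (hub y) \<rightarrow>\<^sup>*\<^bsub>with_proj (corona G H)\<^esub> y"
      using hub[OF y] C.symmetric_reachable' by blast
    ultimately show ?thesis by (rule C.reachable_trans)
  qed
  moreover have "pverts (corona G H) \<noteq> {}"
    using sc by (auto simp: strongly_connected_def)
  ultimately show ?thesis
    unfolding connected_def strongly_connected_def
    by (auto simp del: pverts_corona intro!: C.reachable_mk_symmetricI)
qed

definition central_edges :: "'a pair_pre_digraph \<Rightarrow> 'b pair_pre_digraph \<Rightarrow> ('a + 'a \<times> 'b) set set" where
  "central_edges G H =
     image Inl ` edges G \<union> (\<lambda>(g, h). {Inl g, Inr (g, h)}) ` (pverts G \<times> pverts H)"

definition copy_edges :: "'a pair_pre_digraph \<Rightarrow> 'b pair_pre_digraph \<Rightarrow> ('a + 'a \<times> 'b) set set" where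
  "copy_edges G H = (\<lambda>(g, e). (\<lambda>h. Inr (g, h)) ` e) ` (pverts G \<times> edges H)"

lemma edges_corona: "edges (corona G H) = central_edges G H \<union> copy_edges G H"
proof (intro equalityI subsetI)
  fix e assume "e \<in> edges (corona G H)"
  then obtain a b where e: "e = {a, b}" and ab: "(a, b) \<in> parcs (corona G H)"
    by (auto simp: edges_def)
  from ab show "e \<in> central_edges G H \<union> copy_edges G H"
  proof (cases rule: corona_arc_cases)
    case (centre g g')
    then have "e = Inl ` {g, g'}" "{g, g'} \<in> edges G" by (auto simp: e edges_def)
    then show ?thesis unfolding central_edges_def by blast
  next
    case (copy g h h')
    then have "e = (\<lambda>h. Inr (g, h)) ` {h, h'}" "{h, h'} \<in> edges H" by (auto simp: e edges_def)
    with copy(3) show ?thesis unfolding copy_edges_def by blast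
  next
    case (outward g h)
    then show ?thesis by (auto simp: e central_edges_def)
  next
    case (inward g h)
    then have "e = {Inl g, Inr (g, h)}" by (auto simp: e)
    with inward show ?thesis by (auto simp: central_edges_def)
  qed
next
  fix e assume "e \<in> central_edges G H \<union> copy_edges G H"
  then consider (centre) g g' where "e = {Inl g, Inl g'}" "(g, g') \<in> parcs G"
    | (spoke) g h where "e = {Inl g, Inr (g, h)}" "g \<in> pverts G" "h \<in> pverts H"
    | (copy) g h h' where "e = {Inr (g, h), Inr (g, h')}" "g \<in> pverts G" "(h, h') \<in> parcs H"
    by (auto simp: central_edges_def copy_edges_def edges_def)
  then obtain a b where "e = {a, b}" "(a, b) \<in> parcs (corona G H)"
    by cases (metis parcs_corona)+
  then show "e \<in> edges (corona G H)" by (auto simp: edges_def)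
qed

lemma finite_edges: "pair_graph G \<Longrightarrow> finite (edges G)"
proof -
  assume "pair_graph G"
  then interpret pair_graph G .
  have "edges G = (\<lambda>(u, v). {u, v}) ` parcs G" by (auto simp: edges_def)
  then show ?thesis by (simp add: pair_finite_arcs)
qed

lemma card_central_edges:
  assumes "pair_graph G" "pair_graph H"
  shows "card (central_edges G H) = graph_size G + graph_order G * graph_order H"
proof -
  interpret G: pair_graph G by fact
  interpret H: pair_graph H by fact
  have "card (image (Inl :: 'a \<Rightarrow> 'a + 'a \<times> 'b) ` edges G) = graph_size G"
    unfolding graph_size_def by (intro card_image inj_on_image) auto
  moreover have "card ((\<lambda>(g, h). {Inl g, Inr (g, h)}) ` (pverts G \<times> pverts H))
      = graph_order G * graph_order H"
    unfolding graph_order_def card_cartesian_product[symmetric]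
    by (intro card_image) (auto simp: inj_on_def doubleton_eq_iff)
  moreover have "image Inl ` edges G \<inter> (\<lambda>(g, h). {Inl g, Inr (g, h)}) ` (pverts G \<times> pverts H) = {}"
    by auto
  ultimately show ?thesis
    unfolding central_edges_def
    by (subst card_Un_disjoint)
      (simp_all add: finite_edges assms G.pair_finite_verts H.pair_finite_verts)
qed

lemma card_copy_edges: "card (copy_edges G H) = graph_order G * graph_size H"
proof -
  have "inj_on (\<lambda>(g, e). (\<lambda>h. Inr (g, h) :: 'a + 'a \<times> 'b) ` e) (pverts G \<times> edges H)"
  proof (rule inj_onI, clarify)
    fix g g' e e'
    assume "e \<in> edges H" "e' \<in> edges H"
      and eq: "(\<lambda>h. Inr (g, h) :: 'a + 'a \<times> 'b) ` e = (\<lambda>h. Inr (g', h)) ` e'"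
    then obtain h where "h \<in> e" by (auto simp: edges_def)
    then have "Inr (g, h) \<in> (\<lambda>h. Inr (g', h) :: 'a + 'a \<times> 'b) ` e'"
      unfolding eq[symmetric] by simp
    then have "g = g'" by auto
    with eq have "e = e'" by (simp add: inj_image_eq_iff inj_def)
    with \<open>g = g'\<close> show "g = g' \<and> e = e'" by simp
  qed
  then show ?thesis
    by (simp add: copy_edges_def card_image card_cartesian_product graph_order_def graph_size_def)
qed

section \<open>Counting labels by residue class\<close>

lemma card_multiples:
  fixes n k :: int
  assumes "n > 0"
  shows "card {x \<in> {1..n * k}. n dvd x} = nat k"
proof -
  have "bij_betw ((*) n) {1..k} {x \<in> {1..n * k}. n dvd x}"
  proof (rule bij_betw_imageI)
    show "inj_on ((*) n) {1..k}" using assms by (simp add: inj_on_def)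
    have "x \<in> (*) n ` {1..k}" if "x \<in> {1..n * k}" "n dvd x" for x
    proof -
      from that(2) obtain j where "x = n * j" by blast
      with that(1) assms show ?thesis
        by (auto intro!: imageI simp: int_one_le_iff_zero_less zero_less_mult_iff)
    qed
    moreover have "1 \<le> n * j" if "1 \<le> j" for j
      using that assms by (simp add: int_one_le_iff_zero_less)
    ultimately show "(*) n ` {1..k} = {x \<in> {1..n * k}. n dvd x}"
      using assms by auto
  qed
  from bij_betw_same_card[OF this] show ?thesis by simp
qed

text \<open>
  Division with remainder identifies the integers from \<open>0\<close> to \<open>n k - 1\<close> with the pairs of a quotient
  below \<open>k\<close> and a remainder. Since the remainders considered are nonzero, the interval may be shifted to
  start at \<open>1\<close>: neither \<open>0\<close> nor \<open>n k\<close> is counted.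
\<close>
lemma card_nonzero_residues:
  fixes n k :: int
  assumes "n > 0" "k \<ge> 0" and R: "R \<subseteq> {1..n - 1}"
  shows "card {x \<in> {1..n * k}. x mod n \<in> R} = nat k * card R"
proof -
  have "bij_betw (\<lambda>(q, r). n * q + r) ({0..<k} \<times> R) {x \<in> {1..n * k}. x mod n \<in> R}"
  proof (rule bij_betw_byWitness[where f' = "\<lambda>x. (x div n, x mod n)"])
    show "\<forall>a\<in>{0..<k} \<times> R. (\<lambda>x. (x div n, x mod n)) ((\<lambda>(q, r). n * q + r) a) = a"
      using R assms(1) by (auto simp: div_pos_pos_trivial mod_pos_pos_trivial)
    have "n * q + r \<in> {1..n * k} \<and> (n * q + r) mod n \<in> R" if q: "q \<in> {0..<k}" and r: "r \<in> R" for q r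
    proof -
      from r R have r': "1 \<le> r" "r < n" by auto
      have "n * q \<ge> 0" using q assms by simp
      moreover have "n * q + n \<le> n * k"
        using q assms mult_left_mono[of "q + 1" k n] by (simp add: algebra_simps)
      ultimately show ?thesis
        using r r' by (auto simp: mod_pos_pos_trivial)
    qed
    then show "(\<lambda>(q, r). n * q + r) ` ({0..<k} \<times> R) \<subseteq> {x \<in> {1..n * k}. x mod n \<in> R}"
      by auto
    have "x div n \<in> {0..<k}" if x: "x \<in> {1..n * k}" and r: "x mod n \<in> R" for x
    proof -
      from r R have "x mod n > 0" by auto
      then have "x \<noteq> n * k" by auto
      with x have "0 \<le> x" "x < n * k" by auto
      have "n * (x div n) \<le> x"
        using mult_div_mod_eq[of n x] \<open>x mod n > 0\<close> by linarith
      with \<open>x < n * k\<close> have "n * (x div n) < n * k" by linarith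
      then have "x div n < k" using assms(1) by (simp add: mult_less_cancel_left_pos)
      with \<open>0 \<le> x\<close> assms(1) show ?thesis
        by (simp add: pos_imp_zdiv_nonneg_iff)
    qed
    then show "(\<lambda>x. (x div n, x mod n)) ` {x \<in> {1..n * k}. x mod n \<in> R} \<subseteq> {0..<k} \<times> R"
      by auto
  qed auto
  from bij_betw_same_card[OF this] show ?thesis
    by (simp add: card_cartesian_product)
qed

section \<open>The labeling\<close>

text \<open>
  The class \<open>B0\<close> exactly fills \<open>k0\<close> copies of \<open>W\<close> and \<open>B1\<close> exactly fills the other \<open>k1\<close>, so no copy
  has to mix the classes; which copies receive which class is arbitrary.
\<close>
lemma ex_bij_copies_monochromatic:
  fixes V :: "'a set" and W :: "'b set" and M B0 B1 :: "'c set"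
  assumes fin: "finite V" "finite W" "finite M" "finite B0" "finite B1"
    and disj: "M \<inter> (B0 \<union> B1) = {}" "B0 \<inter> B1 = {}"
    and cardM: "card M = card V" and cardV: "card V = k0 + k1"
    and cardB: "card B0 = k0 * card W" "card B1 = k1 * card W"
  obtains f where "bij_betw f (Inl ` V \<union> Inr ` (V \<times> W)) (M \<union> (B0 \<union> B1))"
    and "\<And>g. g \<in> V \<Longrightarrow> f (Inl g) \<in> M"
    and "\<And>g. g \<in> V \<Longrightarrow> (\<forall>h\<in>W. f (Inr (g, h)) \<in> B0) \<or> (\<forall>h\<in>W. f (Inr (g, h)) \<in> B1)"
proof -
  obtain V0 where V0: "V0 \<subseteq> V" "card V0 = k0"
    using cardV by (metis le_add1 obtain_subset_with_card_n)
  define V1 where "V1 = V - V0"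
  have V1: "card V1 = k1"
    unfolding V1_def using V0 cardV fin(1) by (simp add: card_Diff_subset finite_subset)
  have finV: "finite V0" "finite V1" using V0(1) fin(1) by (auto simp: V1_def finite_subset)
  obtain fM where fM: "bij_betw fM V M"
    using finite_same_card_bij fin(1,3) cardM by metis
  obtain f0 where f0: "bij_betw f0 (V0 \<times> W) B0"
    using finite_same_card_bij[of "V0 \<times> W" B0] finV fin V0(2) cardB(1)
    by (auto simp: card_cartesian_product)
  obtain f1 where f1: "bij_betw f1 (V1 \<times> W) B1"
    using finite_same_card_bij[of "V1 \<times> W" B1] finV fin V1 cardB(2)
    by (auto simp: card_cartesian_product)
  define fc where "fc x = (if fst x \<in> V0 then f0 x else f1 x)" for x
  have "bij_betw fc (V0 \<times> W \<union> V1 \<times> W) (B0 \<union> B1)"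
  proof (rule bij_betw_combine)
    show "bij_betw fc (V0 \<times> W) B0"
      using f0 by (rule bij_betw_cong[THEN iffD1, rotated]) (auto simp: fc_def)
    show "bij_betw fc (V1 \<times> W) B1"
      using f1 by (rule bij_betw_cong[THEN iffD1, rotated]) (auto simp: fc_def V1_def)
  qed (rule disj(2))
  moreover have "V0 \<times> W \<union> V1 \<times> W = V \<times> W" using V0(1) by (auto simp: V1_def)
  ultimately have fc: "bij_betw fc (V \<times> W) (B0 \<union> B1)" by simp
  have "bij_betw (case_sum fM fc) (Inl ` V \<union> Inr ` (V \<times> W)) (M \<union> (B0 \<union> B1))"
  proof (rule bij_betw_combine)
    show "bij_betw (case_sum fM fc) (Inl ` V) M"
      using fM by (auto simp: bij_betw_def inj_on_def image_image)
    show "bij_betw (case_sum fM fc) (Inr ` (V \<times> W)) (B0 \<union> B1)"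
      using fc by (simp add: bij_betw_def inj_on_def image_image)
  qed (rule disj(1))
  moreover have "case_sum fM fc (Inl g) \<in> M" if "g \<in> V" for g
    using that fM by (auto simp: bij_betw_def)
  moreover have "(\<forall>h\<in>W. case_sum fM fc (Inr (g, h)) \<in> B0) \<or> (\<forall>h\<in>W. case_sum fM fc (Inr (g, h)) \<in> B1)"
    if "g \<in> V" for g
    using that f0 f1 by (cases "g \<in> V0") (auto simp: fc_def V1_def bij_betw_def)
  ultimately show ?thesis by (rule that)
qed

text \<open>
  For a commutative operation, here multiplication, the induced edge labeling is a function of the
  unordered edge. In a graph without loops, the product over the two-element set \<open>{a, b}\<close> is
  \<open>f a * f b\<close>, which gives that function in closed form.
\<close>
lemma induced_edge_labeling_prod:
  assumes "pair_graph \<Gamma>"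
  shows "induced_edge_labeling \<eta> \<zeta> (*) \<Gamma> f (\<lambda>e. label_of_value \<eta> \<zeta> (\<Prod>x\<in>e. f x))"
proof -
  interpret pair_graph \<Gamma> by fact
  show ?thesis by (auto simp: induced_edge_labeling_def dest: no_loops')
qed

theorem theorem5p5:
  fixes p m :: nat and \<epsilon> :: int
    and \<zeta> :: "int \<Rightarrow> nat" and \<chi> :: "int \<Rightarrow> int"
    and G :: "'a pair_pre_digraph" and H :: "'b pair_pre_digraph"
  assumes "prime p" and "odd p" and "p \<ge> 3" and "m \<ge> 1"
    and "\<zeta> \<in> coprime_ints (int p) \<rightarrow> {0, 1}"
    and "\<And>\<theta>\<^sub>1 \<theta>\<^sub>2. \<lbrakk>gcd \<theta>\<^sub>1 (int p) = 1; gcd \<theta>\<^sub>2 (int p) = 1; [\<theta>\<^sub>1 = \<theta>\<^sub>2] (mod int p)\<rbrakk>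
           \<Longrightarrow> \<zeta> \<theta>\<^sub>1 = \<zeta> \<theta>\<^sub>2"
    and "\<And>i. i \<in> {0, 1} \<Longrightarrow>
           real (card {a::int. \<zeta> a = i \<and> 1 \<le> a \<and> a \<le> int p - 1}) = (real p - 1) / 2"
    and "\<chi> \<in> coprime_ints (int p) \<rightarrow> {-1, 1}"
    and "\<And>\<theta>\<^sub>1 \<theta>\<^sub>2. \<lbrakk>gcd \<theta>\<^sub>1 (int p) = 1; gcd \<theta>\<^sub>2 (int p) = 1\<rbrakk>
           \<Longrightarrow> \<chi> (\<theta>\<^sub>1 * \<theta>\<^sub>2) = \<chi> \<theta>\<^sub>1 * \<chi> \<theta>\<^sub>2"
    and "\<And>\<theta>. gcd \<theta> (int p) = 1 \<Longrightarrow> real (\<zeta> \<theta>) = (1 + real_of_int (\<chi> \<theta>)) / 2"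
    and "\<epsilon> \<in> {-1, 0, 1}"
    and "pair_graph G" and "Digraph_Component.connected (with_proj G)"
    and "graph_order G = p - 1" and "int (graph_size G) = int m * (int p - 1) + \<epsilon>"
    and "pair_graph H"
    and "graph_order H = p - 1" and "graph_size H = p - 1 + m"
  shows "arithmetic_cordial_graph (int p) {1..int p * (int p - 1)} \<zeta> (*) (corona G H)"
proof -
  note p = assms(1) and period = assms(6) and balance = assms(7) and chi_range = assms(8)
    and chi_mult = assms(9) and zeta_chi = assms(10) and G = assms(12) and H = assms(16)
  interpret G: pair_graph G by (fact G)
  interpret H: pair_graph H by (fact H)
  interpret C: pair_graph "corona G H" using G H by (rule pair_graph_corona)
  define S where "S = {1..int p * (int p - 1)}"
  define k where "k = (p - 1) div 2"
  have k: "p - 1 = k + k" using assms(2) by (auto simp: k_def elim: oddE)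
  have n: "nat (int p - 1) = p - 1" "int (p - 1) = int p - 1" "real (p - 1) = real p - 1"
    and p_pos: "int p > 0" "int p - 1 \<ge> 0"
    using assms(3) by auto
  have unit_iff: "gcd x (int p) = 1 \<longleftrightarrow> \<not> int p dvd x" for x
  proof
    assume "gcd x (int p) = 1"
    then show "\<not> int p dvd x" using assms(3) by (auto simp: gcd_proj2_if_dvd)
  next
    assume "\<not> int p dvd x"
    then have "coprime (int p) x" using p by (intro prime_imp_coprime) simp_all
    then show "gcd x (int p) = 1" by (simp add: gcd.commute coprime_iff_gcd_eq_1)
  qed
  define M where "M = {x \<in> S. int p dvd x}"
  define B where "B i = {x \<in> S. \<not> int p dvd x \<and> \<zeta> x = i}" for i
  have card_M: "card M = p - 1"
    unfolding M_def S_def using card_multiples[of "int p" "int p - 1"] p_pos n(1) by simp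

  have card_B: "card (B i) = k * (p - 1)" if i: "i \<in> {0, 1}" for i
  proof -
    define R where "R = {a::int. \<zeta> a = i \<and> 1 \<le> a \<and> a \<le> int p - 1}"
    have "real (card R) = real (p - 1) / 2"
      unfolding R_def n(3) by (rule balance[OF i])
    then have "card R = k" unfolding k by simp
    have residue_iff: "\<not> int p dvd x \<and> \<zeta> x = i \<longleftrightarrow> x mod int p \<in> R" for x
    proof (cases "int p dvd x")
      case True
      then show ?thesis by (simp add: R_def)
    next
      case False
      then have "x mod int p \<noteq> 0" by (simp only: dvd_eq_mod_eq_0 not_False_eq_True)
      then have "0 < x mod int p" "x mod int p < int p"
        using pos_mod_sign[OF p_pos(1), of x] pos_mod_bound[OF p_pos(1), of x] by linarith+
      moreover have "\<zeta> (x mod int p) = \<zeta> x"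
      proof (rule period)
        show "gcd x (int p) = 1" using False unfolding unit_iff .
        show "gcd (x mod int p) (int p) = 1" using False unfolding unit_iff by (simp add: dvd_mod_iff)
        show "[x mod int p = x] (mod int p)" by (simp add: cong_def)
      qed
      ultimately show ?thesis using False unfolding R_def by simp
    qed
    have "B i = {x \<in> {1..int p * (int p - 1)}. x mod int p \<in> R}"
      unfolding B_def S_def residue_iff by (rule refl)
    moreover have "R \<subseteq> {1..int p - 1}" by (auto simp: R_def)
    ultimately have "card (B i) = (p - 1) * card R"
      using card_nonzero_residues[OF p_pos, of R] n(1) by simp
    with \<open>card R = k\<close> show ?thesis by simp
  qed

  have S_split: "S = M \<union> (B 0 \<union> B 1)"
    using assms(5) unit_iff by (fastforce simp: M_def B_def)
  have fin: "finite M" "finite (B 0)" "finite (B 1)"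
    using S_split finite_atLeastAtMost_int unfolding S_def by (metis finite_Un)+
  obtain f where bij: "bij_betw f (Inl ` pverts G \<union> Inr ` (pverts G \<times> pverts H)) (M \<union> (B 0 \<union> B 1))"
    and centre: "\<And>g. g \<in> pverts G \<Longrightarrow> f (Inl g) \<in> M"
    and mono: "\<And>g. g \<in> pverts G \<Longrightarrow>
      (\<forall>h\<in>pverts H. f (Inr (g, h)) \<in> B 0) \<or> (\<forall>h\<in>pverts H. f (Inr (g, h)) \<in> B 1)"
  proof (rule ex_bij_copies_monochromatic[of "pverts G" "pverts H" M "B 0" "B 1" k k])
    show "card (B 0) = k * card (pverts H)" "card (B 1) = k * card (pverts H)"
      using card_B assms(17) by (simp_all add: graph_order_def)
    show "card M = card (pverts G)" "card (pverts G) = k + k"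
      using card_M assms(14) k by (simp_all add: graph_order_def)
    show "M \<inter> (B 0 \<union> B 1) = {}" "B 0 \<inter> B 1 = {}"
      by (auto simp: M_def B_def)
  qed (use fin in \<open>simp_all add: G.pair_finite_verts H.pair_finite_verts\<close>)

  define F where "F e = label_of_value (int p) \<zeta> (\<Prod>x\<in>e. f x)" for e
  have F_eq: "F {a, b} = label_of_value (int p) \<zeta> (f a * f b)"
    if "(a, b) \<in> parcs (corona G H)" for a b
    using C.no_loops'[OF that] by (simp add: F_def)
  have F_central: "F e = 0" if "e \<in> central_edges G H" for e
  proof -
    from that consider g g' where "e = {Inl g, Inl g'}" "(g, g') \<in> parcs G"
      | g h where "e = {Inl g, Inr (g, h)}" "g \<in> pverts G" "h \<in> pverts H"
      by (auto simp: central_edges_def edges_def)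
    then obtain g b where e: "e = {Inl g, b}" "g \<in> pverts G" "(Inl g, b) \<in> parcs (corona G H)"
      by cases (metis parcs_corona G.in_arcsD1)+
    have "int p dvd f (Inl g) * f b"
      using centre[OF e(2)] by (simp add: M_def)
    then have "gcd (f (Inl g) * f b) (int p) \<noteq> 1"
      unfolding unit_iff by blast
    then show ?thesis
      unfolding e(1) F_eq[OF e(3)] label_of_value_def by (simp only: simp_thms if_True)
  qed
  have F_copy: "F e = 1" if "e \<in> copy_edges G H" for e
  proof -
    from that obtain g h h' where e: "e = {Inr (g, h), Inr (g, h')}"
      and g: "g \<in> pverts G" and hh': "(h, h') \<in> parcs H"
      by (auto simp: copy_edges_def edges_def)
    define x y where "x = f (Inr (g, h))" and "y = f (Inr (g, h'))"
    have "\<zeta> x = \<zeta> y" and ux: "gcd x (int p) = 1" and uy: "gcd y (int p) = 1"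
      using mono[OF g] H.in_arcsD1[OF hh'] H.in_arcsD2[OF hh']
      by (auto simp: x_def y_def B_def unit_iff)
    then have "\<chi> x = \<chi> y"
      using zeta_chi[OF ux] zeta_chi[OF uy] by simp
    moreover have "\<chi> x = -1 \<or> \<chi> x = 1" using chi_range ux by auto
    ultimately have "\<chi> (x * y) = 1" using chi_mult[OF ux uy] by auto
    moreover have uxy: "gcd (x * y) (int p) = 1"
      using ux uy by (simp add: coprime_iff_gcd_eq_1[symmetric])
    ultimately have "\<zeta> (x * y) = 1" using zeta_chi[OF uxy] by simp
    then show ?thesis
      using F_eq[of "Inr (g, h)" "Inr (g, h')"] g hh' uxy
      by (simp add: e label_of_value_def x_def y_def)
  qed

  have "{e \<in> edges (corona G H). F e = 0} = central_edges G H"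
    "{e \<in> edges (corona G H). F e = 1} = copy_edges G H"
    using F_central F_copy by (force simp: edges_corona)+
  then have "int (num_edges_labeled (corona G H) F 0) - int (num_edges_labeled (corona G H) F 1)
      = int (graph_size G + (p - 1) * (p - 1)) - int ((p - 1) * (p - 1 + m))"
    using card_central_edges[OF G H] card_copy_edges[of G H] assms(14,17,18)
    by (simp add: num_edges_labeled_def)
  also have "\<dots> = \<epsilon>"
    using assms(15) by (simp only: n(2) of_nat_add of_nat_mult) (simp add: algebra_simps)
  finally have count: "\<bar>int (num_edges_labeled (corona G H) F 0)
      - int (num_edges_labeled (corona G H) F 1)\<bar> \<le> 1"
    using assms(11) by auto
  have "induced_edge_labeling (int p) \<zeta> (*) (corona G H) f F"
    using induced_edge_labeling_prod[OF C.pair_graph] by (simp add: F_def[abs_def])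
  with count have "arithmetic_cordial_labeling (int p) S \<zeta> (*) (corona G H) f"
    unfolding arithmetic_cordial_labeling_def using bij by (auto simp: S_split)
  then show ?thesis
    unfolding arithmetic_cordial_graph_def S_def[symmetric]
    using p_pos(1) assms(5) C.pair_graph connected_corona[OF G H assms(13)] by blast
qed

end
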